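(* Let $m\ge 1$ and $n\ge 2$ be integers and let $\alpha\ge 1$ be real. Let $X_{m,n}=\{x_{m,n,1},\dots,x_{m,n,n}\}$ be the set of the positive zeros of the exceptional Laguerre polynomial of the first kind $L_{m,m+n}^{I,(\alpha)}$. Then $X_{m,n}$ is the unique set of minimal energy (Fekete set) on $(0,\infty)$ with respect to the external field represented by the weight $\left(v_{m,n}^{(\alpha+1)}\right)^{\frac{1}{2(n-1)}}$; that is, the function $$T_v(u_1,\dots,u_n)=\prod_{j=1}^n v(u_j)\prod_{1\le i<j\le n}(u_i-u_j)^2,\qquad v=v_{m,n}^{(\alpha+1)},$$ on $(0,\infty)^n$ attains its maximum exactly at the points $(u_1,\dots,u_n)$ with $\{u_1,\dots,u_n\}=X_{m,n}$.
   Context: $L_k^{(a)}$ denotes the classical Laguerre polynomial of degree $k$ with parameter $a$ (leading coefficient $(-1)^k/k!$), satisfying $xy''+(a+1-x)y'+ky=0$. Exceptional Laguerre polynomials of the first kind of codimension $m\ge1$: for $\alpha>0$ and $n\ge 0$, with $S(x)=L_m^{(\alpha-1)}(-x)$, $L_{m,m+n}^{I,(\alpha)}$ is the polynomial of degree $m+n$ with leading coefficient $\frac{(-1)^n}{m!\,n!}$ which satisfies $$y''(x)+\left(\frac{\alpha+1-x}{x}-\frac{2S'(x)}{S(x)}\right)y'(x)+\left(\frac{m+n}{x}-\frac{\alpha}{x}\frac{2S'(x)}{S(x)}\right)y(x)=0$$ (away from $0$ and the zeros of $S$); these conditions determine it uniquely. It is known that for $\alpha>0$ it has exactly $m$ simple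 zeros $z_{m,n,1}>\dots>z_{m,n,m}$ in $(-\infty,0)$ (exceptional zeros) and exactly $n$ simple zeros $x_{m,n,1}<\dots<x_{m,n,n}$ in $(0,\infty)$ (regular zeros). Put $P_{m,n}(x)=\frac1{m!}\prod_{i=1}^m(x-z_{m,n,i})$ and $$v_{m,n}^{(\alpha+1)}(x)=\frac{x^{\alpha+1}e^{-x}P_{m,n}(x)^2}{S(x)^2},\qquad x\in(0,\infty).$$ *)

theory Defs
  imports "HOL-Analysis.Analysis" "HOL-Computational_Algebra.Polynomial"
begin

section \<open>Classical Laguerre polynomials\<close>

definition laguerre :: "nat \<Rightarrow> real \<Rightarrow> real poly" where
  "laguerre k a =
     (\<Sum>i\<le>k. monom ((-1) ^ i * ((real k + a) gchoose (k - i)) / fact i) i)"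

lemma coeff_laguerre:
  "coeff (laguerre k a) i =
     (if i \<le> k then (-1) ^ i * ((real k + a) gchoose (k - i)) / fact i else 0)"
  by (simp add: laguerre_def coeff_sum)

lemma degree_laguerre: "degree (laguerre k a) = k"
proof (rule antisym)
  show "degree (laguerre k a) \<le> k"
    by (rule degree_le) (simp add: coeff_laguerre)
  show "k \<le> degree (laguerre k a)"
    by (rule le_degree) (simp add: coeff_laguerre)
qed

lemma lead_coeff_laguerre: "lead_coeff (laguerre k a) = (-1) ^ k / fact k"
  by (simp add: degree_laguerre coeff_laguerre)

lemma coeff_laguerre_Suc:
  "real (Suc j) * (real j + a + 1) * coeff (laguerre k a) (Suc j) =
     (real j - real k) * coeff (laguerre k a) j"
proof (cases "j < k")
  case True
  define r where "r = k - Suc j"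
  have k: "k - j = Suc r" "k - Suc j = r" "real k = real r + real j + 1"
    using True by (auto simp: r_def)
  have "(real r + 1) * ((real k + a) gchoose Suc r) =
          (real k + a - real r) * ((real k + a) gchoose r)"
    by (simp add: gbinomial_mult_1 algebra_simps)
  also have "real k + a - real r = real j + a + 1"
    by (simp add: k)
  finally have "(real r + 1) * ((real k + a) gchoose Suc r) =
          (real j + a + 1) * ((real k + a) gchoose r)" .
  note rec = this
  let ?c = "(-1) ^ j / fact j :: real"
  have "real (Suc j) * coeff (laguerre k a) (Suc j) = - ?c * ((real k + a) gchoose r)"
    using True k(2) by (simp add: coeff_laguerre divide_simps del: of_nat_Suc)
  hence "real (Suc j) * (real j + a + 1) * coeff (laguerre k a) (Suc j) =
          - ?c * ((real j + a + 1) * ((real k + a) gchoose r))"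
    by (metis mult.assoc mult.left_commute)
  also have "\<dots> = - ?c * ((real r + 1) * ((real k + a) gchoose Suc r))"
    by (simp only: rec)
  also have "\<dots> = - (real r + 1) * coeff (laguerre k a) j"
    using True k(1) by (simp add: coeff_laguerre field_simps)
  also have "- (real r + 1) = real j - real k"
    by (simp add: k)
  finally show ?thesis .
qed (auto simp: coeff_laguerre)

lemma laguerre_ode:
  "x * poly (pderiv (pderiv (laguerre k a))) x
     + (a + 1 - x) * poly (pderiv (laguerre k a)) x
     + real k * poly (laguerre k a) x = 0"
proof -
  let ?L = "laguerre k a"
  have "[:0, 1:] * pderiv (pderiv ?L) + [:a + 1, -1:] * pderiv ?L + [:real k:] * ?L = 0"
  proof (rule poly_eqI)
    fix j
    show "coeff ([:0, 1:] * pderiv (pderiv ?L) + [:a + 1, -1:] * pderiv ?L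
                   + [:real k:] * ?L) j = coeff 0 j"
      using coeff_laguerre_Suc[of j a k]
      by (cases j) (simp_all add: coeff_pderiv coeff_pCons algebra_simps)
  qed
  from arg_cong[OF this, of "\<lambda>p. poly p x"] show ?thesis
    by (simp add: algebra_simps)
qed


section \<open>Exceptional Laguerre polynomials of the first kind\<close>

definition exc_S :: "nat \<Rightarrow> real \<Rightarrow> real poly" where
  "exc_S m \<alpha> = pcompose (laguerre m (\<alpha> - 1)) [:0, -1:]"

lemma poly_exc_S: "poly (exc_S m \<alpha>) x = poly (laguerre m (\<alpha> - 1)) (- x)"
  by (simp add: exc_S_def poly_pcompose)

definition is_exc_laguerre :: "nat \<Rightarrow> nat \<Rightarrow> real \<Rightarrow> real poly \<Rightarrow> bool" where
  "is_exc_laguerre m n \<alpha> y \<longleftrightarrow>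
     degree y = m + n \<and>
     lead_coeff y = (-1) ^ n / (fact m * fact n) \<and>
     (\<forall>x. x \<noteq> 0 \<longrightarrow> poly (exc_S m \<alpha>) x \<noteq> 0 \<longrightarrow>
        poly (pderiv (pderiv y)) x
        + ((\<alpha> + 1 - x) / x - 2 * poly (pderiv (exc_S m \<alpha>)) x / poly (exc_S m \<alpha>) x)
            * poly (pderiv y) x
        + ((real m + real n) / x
            - \<alpha> / x * (2 * poly (pderiv (exc_S m \<alpha>)) x / poly (exc_S m \<alpha>) x))
            * poly y x = 0)"

text \<open>For \<open>m \<ge> 1\<close> and \<open>\<alpha> > 0\<close> the conditions determine the polynomial uniquely; this is
  the exceptional polynomial of codimension \<open>m\<close> and degree \<open>m + n\<close>.\<close>

definition exc_laguerre :: "nat \<Rightarrow> nat \<Rightarrow> real \<Rightarrow> real poly" where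
  "exc_laguerre m n \<alpha> = (THE y. is_exc_laguerre m n \<alpha> y)"

definition exceptional_zeros :: "nat \<Rightarrow> nat \<Rightarrow> real \<Rightarrow> real set" where
  "exceptional_zeros m n \<alpha> = {z. z < 0 \<and> poly (exc_laguerre m n \<alpha>) z = 0}"

definition regular_zeros :: "nat \<Rightarrow> nat \<Rightarrow> real \<Rightarrow> real set" where
  "regular_zeros m n \<alpha> = {x. x > 0 \<and> poly (exc_laguerre m n \<alpha>) x = 0}"

definition exc_P :: "nat \<Rightarrow> nat \<Rightarrow> real \<Rightarrow> real \<Rightarrow> real" where
  "exc_P m n \<alpha> x = 1 / fact m * (\<Prod>z\<in>exceptional_zeros m n \<alpha>. x - z)"

text \<open>The argument \<open>\<alpha>\<close> is the parameter of the polynomials; the weight attached to it,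
  with exponent \<open>\<alpha> + 1\<close>, is the one usually indexed by \<open>\<alpha> + 1\<close>.\<close>

definition exc_v :: "nat \<Rightarrow> nat \<Rightarrow> real \<Rightarrow> real \<Rightarrow> real" where
  "exc_v m n \<alpha> x =
     x powr (\<alpha> + 1) * exp (- x) * (exc_P m n \<alpha> x)\<^sup>2 / (poly (exc_S m \<alpha>) x)\<^sup>2"


section \<open>Fekete sets\<close>

text \<open>The discrete energy of a finite set in the external field \<open>Q = - ln w\<close>: for
  \<open>card F = n\<close> it equals the sum of \<open>ln (1 / \<bar>x - y\<bar>)\<close> over ordered pairs of distinct
  points plus \<open>2 * (n - 1)\<close> times the sum of \<open>Q x\<close>. The weight is assumed to be positive
  on the sets considered.\<close>

definition weighted_energy :: "(real \<Rightarrow> real) \<Rightarrow> real set \<Rightarrow> real" where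
  "weighted_energy w F = (\<Sum>x\<in>F. \<Sum>y\<in>F - {x}. ln (1 / (\<bar>x - y\<bar> * w x * w y)))"

definition is_fekete_set :: "(real \<Rightarrow> real) \<Rightarrow> real set \<Rightarrow> nat \<Rightarrow> real set \<Rightarrow> bool" where
  "is_fekete_set w E n F \<longleftrightarrow>
     F \<subseteq> E \<and> finite F \<and> card F = n \<and>
     (\<forall>G. G \<subseteq> E \<longrightarrow> finite G \<longrightarrow> card G = n \<longrightarrow> weighted_energy w F \<le> weighted_energy w G)"

definition fekete_T :: "(real \<Rightarrow> real) \<Rightarrow> nat \<Rightarrow> (nat \<Rightarrow> real) \<Rightarrow> real" where
  "fekete_T v n u =
     (\<Prod>j\<in>{1..n}. v (u j)) * (\<Prod>j\<in>{1..n}. \<Prod>i\<in>{1..<j}. (u i - u j)\<^sup>2)"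

end

theory Submission
  imports Defs
begin

text \<open>With \<open>S = exc_S m \<alpha>\<close> and \<open>A = laguerre n (\<alpha> - 1)\<close>, the exceptional polynomial is
  \<open>y = S * A + S' * A - S * A'\<close>; it satisfies \<open>x * y' + \<alpha> * y = (m + n + \<alpha>) * S * A\<close>,
  and the exceptional equation follows by differentiating once. At the zeros of \<open>S\<close> and of
  \<open>A\<close> the formula reduces to \<open>S' * A\<close> and \<open>- S * A'\<close>, so sign changes locate all zeros of
  \<open>y\<close> and show that its negative zeros interlace with those of \<open>S\<close>. For \<open>\<alpha> \<ge> 1\<close> this
  interlacing makes the logarithm of the weight strictly concave. The differential equation at
  a positive zero of \<open>y\<close> says that the set of these zeros is a critical point of the logarithmic
  energy, and adding up the tangent inequalities along the increasing bijection with a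
  competing set shows that it is the unique maximiser.\<close>

section \<open>Polynomials with simple real zeros\<close>

lemma poly_eq_prod_roots:
  fixes p :: "real poly"
  assumes "finite R" "card R = degree p" "\<And>r. r \<in> R \<Longrightarrow> poly p r = 0"
  shows "p = smult (lead_coeff p) (\<Prod>r\<in>R. [:- r, 1:])"
proof (rule poly_eqI_degree_lead_coeff[where n = "degree p" and A = R])
  have d: "degree (\<Prod>r\<in>R. [:- r, 1:]) = card R"
    by (subst degree_prod_eq_sum_degree) auto
  have l: "lead_coeff (\<Prod>r\<in>R. [:- r, 1:]) = 1"
    by (subst lead_coeff_prod) auto
  show "coeff p (degree p) = coeff (smult (lead_coeff p) (\<Prod>r\<in>R. [:- r, 1:])) (degree p)"
    using d l assms(2) by simp
  show "degree (smult (lead_coeff p) (\<Prod>r\<in>R. [:- r, 1:])) \<le> degree p"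
    using d assms(2) by simp
  show "poly p z = poly (smult (lead_coeff p) (\<Prod>r\<in>R. [:- r, 1:])) z" if "z \<in> R" for z
  proof -
    have "poly (\<Prod>r\<in>R. [:- r, 1:]) z = 0"
      using that assms(1) by (auto simp: poly_prod)
    thus ?thesis using assms(3)[OF that] by simp
  qed
qed (use assms(2) in auto)

lemma poly_eq_prod_roots':
  fixes p :: "real poly"
  assumes "finite R" "card R = degree p" "\<And>r. r \<in> R \<Longrightarrow> poly p r = 0"
  shows "poly p x = lead_coeff p * (\<Prod>r\<in>R. x - r)"
  by (subst poly_eq_prod_roots[OF assms]) (auto simp: poly_prod)

lemma pderiv_linear_mult: "pderiv ([:- a, 1:] * q) = q + [:- a, 1:] * pderiv q"
  for a :: real
proof -
  have "pderiv [:- a, 1:] = 1" by (simp add: pderiv_pCons)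
  thus ?thesis by (simp add: pderiv_mult del: mult_pCons_left mult_pCons_right)
qed

text \<open>The logarithmic derivative of a product, multiplied out; the induction adds one linear
  factor at a time.\<close>

lemma poly_pderiv_prod_linear:
  fixes x :: real
  assumes "finite R" "x \<notin> R"
  shows "poly (pderiv (\<Prod>r\<in>R. [:- r, 1:])) x = (\<Prod>r\<in>R. x - r) * (\<Sum>r\<in>R. 1 / (x - r))"
  using assms
proof (induction R rule: finite_induct)
  case (insert a R)
  have "poly (pderiv (\<Prod>r\<in>insert a R. [:- r, 1:])) x =
      (\<Prod>r\<in>R. x - r) + (x - a) * ((\<Prod>r\<in>R. x - r) * (\<Sum>r\<in>R. 1 / (x - r)))"
    using insert
    by (simp add: pderiv_linear_mult poly_prod del: mult_pCons_left)
  also have "\<dots> = (\<Prod>r\<in>insert a R. x - r) * (\<Sum>r\<in>insert a R. 1 / (x - r))"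
    using insert by (simp add: field_simps)
  finally show ?case .
qed auto

text \<open>Splitting off \<open>[:- x, 1:]\<close> leaves a cofactor \<open>g\<close> such that, up
  to the leading coefficient, p'(x) = g(x) and p''(x) = 2 g'(x). The second identity later turns the
  differential equation into an equilibrium condition for the zeros.\<close>

lemma pderiv_at_root:
  fixes p :: "real poly"
  assumes "finite R" "card R = degree p" "\<And>r. r \<in> R \<Longrightarrow> poly p r = 0" "x \<in> R"
  shows "poly (pderiv p) x = lead_coeff p * (\<Prod>r\<in>R - {x}. x - r)"
    and "poly (pderiv (pderiv p)) x = 2 * poly (pderiv p) x * (\<Sum>r\<in>R - {x}. 1 / (x - r))"
proof -
  define g where "g = (\<Prod>r\<in>R - {x}. [:- r, 1:])"
  have p: "p = smult (lead_coeff p) ([:- x, 1:] * g)"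
    using poly_eq_prod_roots[OF assms(1-3)] assms(1,4) by (simp add: g_def prod.remove)
  have g: "poly g x = (\<Prod>r\<in>R - {x}. x - r)"
    by (simp add: g_def poly_prod)
  have g': "poly (pderiv g) x = (\<Prod>r\<in>R - {x}. x - r) * (\<Sum>r\<in>R - {x}. 1 / (x - r))"
    unfolding g_def using assms(1) by (intro poly_pderiv_prod_linear) auto
  have p': "pderiv p = smult (lead_coeff p) (g + [:- x, 1:] * pderiv g)"
    by (subst p) (simp only: pderiv_smult pderiv_linear_mult)
  have p'': "pderiv (pderiv p) =
      smult (lead_coeff p) (pderiv g + pderiv g + [:- x, 1:] * pderiv (pderiv g))"
    by (subst p') (simp only: pderiv_smult pderiv_add pderiv_linear_mult add.assoc)
  show 1: "poly (pderiv p) x = lead_coeff p * (\<Prod>r\<in>R - {x}. x - r)"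
    by (subst p') (simp add: g)
  show "poly (pderiv (pderiv p)) x = 2 * poly (pderiv p) x * (\<Sum>r\<in>R - {x}. 1 / (x - r))"
    unfolding 1 by (subst p'') (simp add: g' algebra_simps)
qed

lemma poly_root_above:
  fixes p :: "real poly"
  assumes "poly p b * lead_coeff p < 0"
  shows "\<exists>z>b. poly p z = 0"
proof -
  have *: "\<exists>z>b. poly q z = 0" if neg: "poly q b < 0" and pos: "lead_coeff q > 0" for q :: "real poly"
  proof -
    obtain N where "\<And>x. x \<ge> N \<Longrightarrow> poly q x \<ge> lead_coeff q"
      using poly_pinfty_gt_lc[OF pos] by blast
    hence "poly q (max N (b + 1)) > 0" using pos by (meson less_le_trans max.cobounded1)
    thus ?thesis using poly_IVT_pos[of b "max N (b + 1)" q] neg by fastforce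
  qed
  show ?thesis
    using *[of p] *[of "- p"] assms by (auto simp: mult_less_0_iff)
qed

text \<open>The derivative at a root is, up to the leading coefficient, the product of the
  differences to the other roots. No root lies between two neighbours, so only their mutual
  differences change sign.\<close>

lemma pderiv_neighbouring_roots:
  fixes q :: "real poly"
  assumes b: "strict_mono_on {..<k} b" and "degree q = k" "\<And>i. i < k \<Longrightarrow> poly q (b i) = 0"
    and i: "Suc i < k"
  shows "poly (pderiv q) (b i) * poly (pderiv q) (b (Suc i)) < 0"
proof -
  let ?R = "b ` {..<k}" and ?D = "b ` {..<k} - {b i} - {b (Suc i)}"
  have inj: "inj_on b {..<k}" using b strict_mono_on_imp_inj_on by blast
  have R: "finite ?R" "card ?R = degree q" using inj assms(2) by (auto simp: card_image)
  have root: "poly q r = 0" if "r \<in> ?R" for r using that assms(3) by auto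
  have less: "b i < b (Suc i)" using b i by (auto simp: strict_mono_on_def)
  have "q \<noteq> 0" using i assms(2) by auto
  have 1: "poly (pderiv q) (b i) = lead_coeff q * ((b i - b (Suc i)) * (\<Prod>r\<in>?D. b i - r))"
    using pderiv_at_root(1)[OF R root, of "b i"] i less
    by (subst prod.remove[symmetric]) auto
  have "?D = ?R - {b (Suc i)} - {b i}" by blast
  hence 2: "poly (pderiv q) (b (Suc i)) =
      lead_coeff q * ((b (Suc i) - b i) * (\<Prod>r\<in>?D. b (Suc i) - r))"
    using pderiv_at_root(1)[OF R root, of "b (Suc i)"] i less
      prod.remove[of "?R - {b (Suc i)}" "b i" "\<lambda>r. b (Suc i) - r"]
    by auto
  have "(b i - r) * (b (Suc i) - r) > 0" if r: "r \<in> ?D" for r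
  proof -
    obtain j where j: "r = b j" "j < k" "j \<noteq> i" "j \<noteq> Suc i" using r by auto
    show ?thesis
    proof (cases "j < i")
      case True
      hence "b j < b i" using b i by (auto simp: strict_mono_on_def)
      thus ?thesis using less j(1) by (intro mult_pos_pos) auto
    next
      case False
      hence "b (Suc i) < b j" using b j by (auto simp: strict_mono_on_def)
      thus ?thesis using less j(1) by (intro mult_neg_neg) auto
    qed
  qed
  hence "(\<Prod>r\<in>?D. (b i - r) * (b (Suc i) - r)) > 0" by (intro prod_pos) auto
  moreover have "poly (pderiv q) (b i) * poly (pderiv q) (b (Suc i)) =
      - ((lead_coeff q * (b (Suc i) - b i))\<^sup>2 * (\<Prod>r\<in>?D. (b i - r) * (b (Suc i) - r)))"
  proof -
    have "(l * ((x - y) * A)) * (l * ((y - x) * B)) = - ((l * (y - x))\<^sup>2 * (A * B))"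
      for l x y A B :: real by algebra
    thus ?thesis unfolding 1 2 prod.distrib .
  qed
  moreover have "(lead_coeff q * (b (Suc i) - b i))\<^sup>2 > 0"
    using \<open>q \<noteq> 0\<close> less by simp
  ultimately show ?thesis by (simp only: neg_less_0_iff_less mult_pos_pos)
qed

text \<open>By \<open>neg\<close>, \<open>p\<close> inherits the alternating signs of q' at the
  roots of \<open>q\<close>, so each gap contains a zero of \<open>p\<close>; past the last root the
  leading coefficient forces one more. The degree of \<open>p\<close> is left open, since
  \<open>p\<close> may have further zeros elsewhere.\<close>

lemma interlacing_roots:
  fixes p q :: "real poly"
  assumes b: "strict_mono_on {..<k} b" and deg: "degree q = k"
    and root: "\<And>i. i < k \<Longrightarrow> poly q (b i) = 0"
    and neg: "\<And>i. i < k \<Longrightarrow> poly p (b i) * poly (pderiv q) (b i) < 0"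
    and lead: "lead_coeff p * lead_coeff q > 0"
  obtains z where "strict_mono_on {..<k} z" "\<And>i. i < k \<Longrightarrow> poly p (z i) = 0"
    "\<And>i. i < k \<Longrightarrow> b i < z i" "\<And>i. Suc i < k \<Longrightarrow> z i < b (Suc i)"
proof -
  have "\<exists>z. b i < z \<and> (Suc i < k \<longrightarrow> z < b (Suc i)) \<and> poly p z = 0" if i: "i < k" for i
  proof (cases "Suc i < k")
    case True
    have "poly (pderiv q) (b i) * poly (pderiv q) (b (Suc i)) < 0"
      by (rule pderiv_neighbouring_roots[OF b deg root True])
    hence "poly p (b i) * poly p (b (Suc i)) < 0"
      using neg[OF i] neg[OF True] by (auto simp: mult_less_0_iff)
    moreover have "b i < b (Suc i)" using b True by (auto simp: strict_mono_on_def)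
    ultimately show ?thesis using poly_IVT[of "b i" "b (Suc i)" p] True by auto
  next
    case False
    hence k: "k = Suc i" using i by auto
    let ?R = "b ` {..<k}"
    have inj: "inj_on b {..<k}" using b strict_mono_on_imp_inj_on by blast
    \<comment> \<open>At the largest root all differences are positive, so q' has the sign of
      \<open>lead_coeff q\<close> there, and \<open>p\<close> the sign opposite to that of
      \<open>lead_coeff p\<close>.\<close>
    have "poly (pderiv q) (b i) = lead_coeff q * (\<Prod>r\<in>?R - {b i}. b i - r)"
      by (rule pderiv_at_root(1)) (use inj deg root i in \<open>auto simp: card_image\<close>)
    moreover have "(\<Prod>r\<in>?R - {b i}. b i - r) > 0"
      using b by (intro prod_pos) (auto simp: k less_Suc_eq strict_mono_on_def)
    ultimately have "poly p (b i) * lead_coeff p < 0"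
      using neg[OF i] lead by (auto simp: mult_less_0_iff zero_less_mult_iff)
    thus ?thesis using poly_root_above False by blast
  qed
  then obtain z where z: "\<And>i. i < k \<Longrightarrow> b i < z i \<and> (Suc i < k \<longrightarrow> z i < b (Suc i)) \<and> poly p (z i) = 0"
    by metis
  have "strict_mono_on {..<k} z"
  proof (rule strict_mono_onI)
    fix i j assume ij: "i \<in> {..<k}" "j \<in> {..<k}" "i < j"
    hence "z i < b (Suc i)" "b j < z j" using z by auto
    moreover have "b (Suc i) \<le> b j"
      using b ij by (cases "Suc i = j") (auto simp: strict_mono_on_def intro!: less_imp_le)
    ultimately show "z i < z j" by linarith
  qed
  thus ?thesis by (rule that) (use z in auto)
qed

section \<open>Zeros of Laguerre polynomials\<close>

lemma pderiv_laguerre_Suc: "pderiv (laguerre (Suc k) a) = - laguerre k (a + 1)"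
proof (rule poly_eqI)
  fix i
  have *: "real (Suc k) + a = real k + (a + 1)" by simp
  show "coeff (pderiv (laguerre (Suc k) a)) i = coeff (- laguerre k (a + 1)) i"
    unfolding coeff_pderiv coeff_minus coeff_laguerre *
    by (simp add: field_simps del: of_nat_Suc)
qed

text \<open>The value at 0 is the binomial coefficient (a+1)(a+2)...(a+k)/k!.\<close>

lemma poly_laguerre_0_pos: "a > -1 \<Longrightarrow> poly (laguerre k a) 0 > 0"
  by (auto simp: poly_0_coeff_0 coeff_laguerre gbinomial_prod_rev intro!: prod_pos divide_pos_pos)

lemma laguerre_nonzero [simp]: "laguerre k a \<noteq> 0"
  using lead_coeff_laguerre[of k a] by auto

text \<open>The zeros of \<open>laguerre (Suc k) a\<close> interlace with those of \<open>x * (laguerre (Suc k) a)'\<close>,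
  which are \<open>0\<close> and the zeros of \<open>laguerre k (a + 1)\<close>; the differential equation provides the signs.\<close>

lemma laguerre_zeros:
  assumes "a > -1"
  obtains b where "strict_mono_on {..<k} b" "\<And>i. i < k \<Longrightarrow> b i > 0"
    "\<And>i. i < k \<Longrightarrow> poly (laguerre k a) (b i) = 0"
  using assms
proof (induction k arbitrary: a thesis)
  case 0
  show ?case by (rule 0(1)[of "\<lambda>_. 0"]) auto
next
  case (Suc k)
  obtain b where b: "strict_mono_on {..<k} b" "\<And>i. i < k \<Longrightarrow> b i > 0"
    "\<And>i. i < k \<Longrightarrow> poly (laguerre k (a + 1)) (b i) = 0"
    using Suc.IH[of "a + 1"] Suc.prems(2) by auto
  let ?L = "laguerre (Suc k) a"
  define q where "q = [:0, 1:] * pderiv ?L"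
  \<comment> \<open>With 0 put in front of the zeros of \<open>laguerre k (a + 1)\<close>, these are
    the \<open>Suc k\<close> zeros of \<open>q\<close>.\<close>
  define c where "c = case_nat 0 b"
  have c: "strict_mono_on {..<Suc k} c"
    using b(1,2) by (auto simp: strict_mono_on_def c_def split: nat.splits)
  have inj: "inj_on b {..<k}" using b(1) strict_mono_on_imp_inj_on by blast
  have nz: "pderiv ?L \<noteq> 0" by (simp add: pderiv_laguerre_Suc)
  have q': "poly (pderiv q) x = poly (pderiv ?L) x + x * poly (pderiv (pderiv ?L)) x" for x
    by (simp add: q_def pderiv_mult pderiv_pCons)
  have "degree q = Suc k"
    using nz by (simp add: q_def degree_laguerre pderiv_laguerre_Suc)
  moreover have "poly q (c i) = 0" if "i < Suc k" for i
    using that b(3) by (auto simp: q_def c_def pderiv_laguerre_Suc split: nat.splits)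
  moreover have "poly ?L (c i) * poly (pderiv q) (c i) < 0" if i: "i < Suc k" for i
  proof (cases i)
    case 0
    thus ?thesis
      using Suc.prems(2) poly_laguerre_0_pos[of a "Suc k"] poly_laguerre_0_pos[of "a + 1" k]
      by (auto simp: c_def q' pderiv_laguerre_Suc mult_pos_neg)
  next
    case (Suc j)
    have j: "j < k" and ci: "c i = b j" using i Suc by (auto simp: c_def)
    have d0: "poly (pderiv ?L) (b j) = 0" using b(3)[OF j] by (simp add: pderiv_laguerre_Suc)
    \<comment> \<open>At \<open>b j\<close> the differential equation gives q' = x * ?L'' = - (k +
      1) * ?L, so the product in question is negative as soon as \<open>?L\<close> is nonzero there.
      Simplicity of the zeros of \<open>laguerre k (a + 1)\<close> ensures this through
      ?L''.\<close>
    have "poly (pderiv (laguerre k (a + 1))) (b j) \<noteq> 0"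
      using b j inj by (subst pderiv_at_root(1)[of "b ` {..<k}"])
        (auto simp: card_image degree_laguerre coeff_laguerre)
    hence "poly (pderiv (pderiv ?L)) (b j) \<noteq> 0"
      by (simp add: pderiv_laguerre_Suc pderiv_minus)
    moreover have ode: "b j * poly (pderiv (pderiv ?L)) (b j) = - (real (Suc k) * poly ?L (b j))"
      using laguerre_ode[of "b j" "Suc k" a] d0 by simp
    ultimately have "poly ?L (b j) \<noteq> 0" using b(2)[OF j] by auto
    hence "real (Suc k) * (poly ?L (b j))\<^sup>2 > 0" by simp
    thus ?thesis unfolding ci q' d0 ode by (simp add: power2_eq_square algebra_simps)
  qed
  moreover have "lead_coeff ?L * lead_coeff q > 0"
  proof -
    have "lead_coeff q = lead_coeff (pderiv ?L)" by (simp add: q_def lead_coeff_mult)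
    also have "\<dots> = - lead_coeff (laguerre k (a + 1))" by (simp add: pderiv_laguerre_Suc)
    finally show ?thesis by (simp add: lead_coeff_laguerre del: fact_Suc)
  qed
  ultimately obtain z where z: "strict_mono_on {..<Suc k} z"
    "\<And>i. i < Suc k \<Longrightarrow> poly ?L (z i) = 0" "\<And>i. i < Suc k \<Longrightarrow> c i < z i"
    using interlacing_roots[OF c, of q ?L] by metis
  have "c i \<ge> 0" if "i < Suc k" for i
    using that b(2) by (auto simp: c_def intro: less_imp_le split: nat.splits)
  hence "z i > 0" if "i < Suc k" for i using that z(3) le_less_trans by blast
  with z(1,2) show ?case using Suc.prems(1) by blast
qed

text \<open>Factors of the form \<open>b i - x\<close> absorb the sign of the leading coefficient,
  so positivity to the left of all zeros is visible.\<close>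

lemma laguerre_eq_prod:
  assumes "strict_mono_on {..<k} b" "\<And>i. i < k \<Longrightarrow> poly (laguerre k a) (b i) = 0"
  shows "poly (laguerre k a) x = (\<Prod>i<k. b i - x) / fact k"
proof -
  have inj: "inj_on b {..<k}" using assms(1) strict_mono_on_imp_inj_on by blast
  have "poly (laguerre k a) x = lead_coeff (laguerre k a) * (\<Prod>r\<in>b ` {..<k}. x - r)"
    by (rule poly_eq_prod_roots') (use inj assms(2) in \<open>auto simp: card_image degree_laguerre\<close>)
  also have "(\<Prod>r\<in>b ` {..<k}. x - r) = (\<Prod>i<k. (-1) * (b i - x))"
    using inj by (simp add: prod.reindex)
  also have "\<dots> = (-1) ^ k * (\<Prod>i<k. b i - x)"
    unfolding prod.distrib by simp
  finally have "poly (laguerre k a) x =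
      ((-1) ^ k * (-1) ^ k) * ((\<Prod>i<k. b i - x) / fact k)"
    by (simp only: lead_coeff_laguerre mult_ac times_divide_eq_left times_divide_eq_right)
  moreover have "(-1) ^ k * (-1) ^ k = (1 :: real)"
    by (simp flip: power_mult_distrib)
  ultimately show ?thesis by simp
qed

section \<open>The exceptional polynomial and its zeros\<close>

text \<open>The Laguerre equation at \<open>- x\<close>, with one sign per differentiation, solved
  for x * S'' so that this term can be substituted.\<close>

lemma exc_S_ode:
  "x * poly (pderiv (pderiv (exc_S m \<alpha>))) x =
     real m * poly (exc_S m \<alpha>) x - (\<alpha> + x) * poly (pderiv (exc_S m \<alpha>)) x"
  using laguerre_ode[of "- x" m "\<alpha> - 1"]
  by (simp add: exc_S_def pderiv_pcompose pderiv_pCons pderiv_mult pderiv_minus poly_pcompose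
      algebra_simps)

lemma degree_exc_S: "degree (exc_S m \<alpha>) = m"
  by (simp add: exc_S_def degree_pcompose degree_laguerre)

lemma lead_coeff_exc_S: "lead_coeff (exc_S m \<alpha>) = 1 / fact m"
proof -
  have "lead_coeff (exc_S m \<alpha>) = lead_coeff (laguerre m (\<alpha> - 1)) * (-1) ^ m"
    unfolding exc_S_def by (subst lead_coeff_comp) (simp_all add: degree_laguerre)
  thus ?thesis
    by (simp add: lead_coeff_laguerre flip: power_mult_distrib)
qed

text \<open>Since \<open>(laguerre (Suc k) a)' = - laguerre k (a + 1)\<close>, this is the classical expression
  \<open>L_m^(\<alpha>)(-x) * L_n^(\<alpha>-1)(x) + L_m^(\<alpha>-1)(-x) * L_(n-1)^(\<alpha>)(x)\<close>.\<close>

definition exc_poly :: "nat \<Rightarrow> nat \<Rightarrow> real \<Rightarrow> real poly" where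
  "exc_poly m n \<alpha> = exc_S m \<alpha> * laguerre n (\<alpha> - 1)
     + (pderiv (exc_S m \<alpha>) * laguerre n (\<alpha> - 1) - exc_S m \<alpha> * pderiv (laguerre n (\<alpha> - 1)))"

lemma poly_exc_poly:
  "poly (exc_poly m n \<alpha>) x = poly (exc_S m \<alpha>) x * poly (laguerre n (\<alpha> - 1)) x
     + (poly (pderiv (exc_S m \<alpha>)) x * poly (laguerre n (\<alpha> - 1)) x
        - poly (exc_S m \<alpha>) x * poly (pderiv (laguerre n (\<alpha> - 1))) x)"
  by (simp add: exc_poly_def)

lemma exc_poly_degree_lead:
  shows "degree (exc_poly m n \<alpha>) = m + n"
    and "lead_coeff (exc_poly m n \<alpha>) = (-1) ^ n / (fact m * fact n)"
proof -
  let ?S = "exc_S m \<alpha>" and ?A = "laguerre n (\<alpha> - 1)"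
  have nz: "?S \<noteq> 0" using lead_coeff_exc_S[of m \<alpha>] by auto
  have deg: "degree (?S * ?A) = m + n"
    using nz by (simp add: degree_mult_eq degree_exc_S degree_laguerre)
  have *: "coeff (p * q) (m + n) = 0" if "degree p + degree q < m + n" for p q :: "real poly"
    using that degree_mult_le[of p q] by (intro coeff_eq_0) linarith
  have 1: "coeff (pderiv ?S * ?A) (m + n) = 0"
  \<comment> \<open>For \<open>m = 0\<close> differentiation does not lower the degree, as
    \<open>degree 0 = 0\<close>, but then the derivative itself vanishes.\<close>
  proof (cases "m = 0")
    case True
    hence "pderiv ?S = 0" by (simp add: pderiv_eq_0_iff degree_exc_S)
    thus ?thesis by simp
  next
    case False
    thus ?thesis by (intro *) (simp add: degree_pderiv degree_exc_S degree_laguerre)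
  qed
  have 2: "coeff (?S * pderiv ?A) (m + n) = 0"
  proof (cases "n = 0")
    case True
    hence "pderiv ?A = 0" by (simp add: pderiv_eq_0_iff degree_laguerre)
    thus ?thesis by simp
  next
    case False
    thus ?thesis by (intro *) (simp add: degree_pderiv degree_exc_S degree_laguerre)
  qed
  have "coeff (?S * ?A) (m + n) = lead_coeff ?S * lead_coeff ?A"
    using lead_coeff_mult[of ?S ?A] by (simp only: deg)
  hence c: "coeff (exc_poly m n \<alpha>) (m + n) = (-1) ^ n / (fact m * fact n)"
    by (simp add: exc_poly_def 1 2 lead_coeff_exc_S lead_coeff_laguerre)
  have "degree (pderiv ?S * ?A) \<le> m + n" "degree (?S * pderiv ?A) \<le> m + n"
    using degree_mult_le[of "pderiv ?S" ?A] degree_mult_le[of ?S "pderiv ?A"]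
    by (simp_all add: degree_pderiv degree_exc_S degree_laguerre)
  hence "degree (exc_poly m n \<alpha>) \<le> m + n"
    unfolding exc_poly_def using deg by (intro degree_add_le degree_diff_le) auto
  moreover have "degree (exc_poly m n \<alpha>) \<ge> m + n"
    by (rule le_degree) (simp add: c)
  ultimately show deg': "degree (exc_poly m n \<alpha>) = m + n" by simp
  show "lead_coeff (exc_poly m n \<alpha>) = (-1) ^ n / (fact m * fact n)"
    unfolding deg' by (rule c)
qed

text \<open>In the derivative of S' * A - S * A' the mixed terms S' * A' cancel. The two Laguerre
  equations replace x * S'' and x * A'', after which only a multiple of S * A survives the addition
  of \<alpha> * y.\<close>

lemma exc_poly_first_order:
  "pCons 0 (pderiv (exc_poly m n \<alpha>)) + smult \<alpha> (exc_poly m n \<alpha>) =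
     smult (real m + real n + \<alpha>) (exc_S m \<alpha> * laguerre n (\<alpha> - 1))"
proof -
  let ?S = "exc_S m \<alpha>" and ?A = "laguerre n (\<alpha> - 1)"
  have "x * poly (pderiv (exc_poly m n \<alpha>)) x + \<alpha> * poly (exc_poly m n \<alpha>) x =
      (real m + real n + \<alpha>) * (poly ?S x * poly ?A x)" for x
  proof -
    have "x * poly (pderiv (exc_poly m n \<alpha>)) x =
        x * (poly (pderiv ?S) x * poly ?A x + poly ?S x * poly (pderiv ?A) x)
        + (x * poly (pderiv (pderiv ?S)) x) * poly ?A x
        - poly ?S x * (x * poly (pderiv (pderiv ?A)) x)"
      by (simp add: exc_poly_def pderiv_add pderiv_diff pderiv_mult algebra_simps)
    also have "x * poly (pderiv (pderiv ?A)) x =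
        - ((\<alpha> - x) * poly (pderiv ?A) x) - real n * poly ?A x"
      using laguerre_ode[of x n "\<alpha> - 1"] by simp
    finally show ?thesis
      unfolding exc_S_ode poly_exc_poly by (simp add: algebra_simps)
  qed
  thus ?thesis
    by (subst poly_eq_poly_eq_iff[symmetric]) (simp add: fun_eq_iff)
qed

lemma exc_poly_ode:
  fixes m n :: nat and \<alpha> x :: real
  defines "S \<equiv> exc_S m \<alpha>" and "y \<equiv> exc_poly m n \<alpha>"
  shows "x * poly S x * poly (pderiv (pderiv y)) x
    + ((\<alpha> + 1 - x) * poly S x - 2 * x * poly (pderiv S) x) * poly (pderiv y) x
    + ((real m + real n) * poly S x - 2 * \<alpha> * poly (pderiv S) x) * poly y x = 0"
proof -
  let ?A = "laguerre n (\<alpha> - 1)" and ?N = "real m + real n + \<alpha>"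
  have 1: "x * poly (pderiv y) x + \<alpha> * poly y x = ?N * (poly S x * poly ?A x)"
    using arg_cong[OF exc_poly_first_order[of m n \<alpha>], of "\<lambda>p. poly p x"]
    by (simp add: S_def y_def)
  have 2: "x * poly (pderiv (pderiv y)) x + (1 + \<alpha>) * poly (pderiv y) x =
      ?N * (poly (pderiv S) x * poly ?A x + poly S x * poly (pderiv ?A) x)"
    using arg_cong[OF exc_poly_first_order[of m n \<alpha>], of "\<lambda>p. poly (pderiv p) x"]
    by (simp add: S_def y_def pderiv_pCons pderiv_add pderiv_smult pderiv_mult algebra_simps)
  have 3: "poly y x = poly S x * poly ?A x
     + (poly (pderiv S) x * poly ?A x - poly S x * poly (pderiv ?A) x)"
    unfolding S_def y_def by (rule poly_exc_poly)
  \<comment> \<open>The left-hand side is regrouped as S times that of \<open>2\<close>, minus S + 2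
    S' times that of \<open>1\<close>, plus \<open>?N\<close> times S * y.\<close>
  have "x * poly S x * poly (pderiv (pderiv y)) x
    + ((\<alpha> + 1 - x) * poly S x - 2 * x * poly (pderiv S) x) * poly (pderiv y) x
    + ((real m + real n) * poly S x - 2 * \<alpha> * poly (pderiv S) x) * poly y x =
    poly S x * (x * poly (pderiv (pderiv y)) x + (1 + \<alpha>) * poly (pderiv y) x)
    - (poly S x + 2 * poly (pderiv S) x) * (x * poly (pderiv y) x + \<alpha> * poly y x)
    + ?N * poly S x * poly y x"
    by (simp add: algebra_simps)
  also have "\<dots> = 0"
    \<comment> \<open>Now \<open>?N\<close> times S is a common factor and \<open>3\<close> cancels
      the rest; unfolding \<open>3\<close> earlier would destroy the left-hand side of
      \<open>1\<close>.\<close>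
    unfolding 1 2 unfolding 3 by (simp add: algebra_simps)
  finally show ?thesis .
qed

lemma exc_ode_cleared:
  fixes x s s' y y' y'' \<alpha> N :: real
  assumes "x \<noteq> 0" "s \<noteq> 0"
  shows "y'' + ((\<alpha> + 1 - x) / x - 2 * s' / s) * y' + (N / x - \<alpha> / x * (2 * s' / s)) * y = 0
    \<longleftrightarrow> x * s * y'' + ((\<alpha> + 1 - x) * s - 2 * x * s') * y' + (N * s - 2 * \<alpha> * s') * y = 0"
proof -
  have "x * s * y'' + ((\<alpha> + 1 - x) * s - 2 * x * s') * y' + (N * s - 2 * \<alpha> * s') * y =
    x * s * (y'' + ((\<alpha> + 1 - x) / x - 2 * s' / s) * y' + (N / x - \<alpha> / x * (2 * s' / s)) * y)"
    using assms by (simp add: field_simps)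
  thus ?thesis using assms by simp
qed

lemma is_exc_laguerre_iff:
  "is_exc_laguerre m n \<alpha> y \<longleftrightarrow>
     degree y = m + n \<and> lead_coeff y = (-1) ^ n / (fact m * fact n) \<and>
     (\<forall>x. x \<noteq> 0 \<longrightarrow> poly (exc_S m \<alpha>) x \<noteq> 0 \<longrightarrow>
        x * poly (exc_S m \<alpha>) x * poly (pderiv (pderiv y)) x
        + ((\<alpha> + 1 - x) * poly (exc_S m \<alpha>) x - 2 * x * poly (pderiv (exc_S m \<alpha>)) x)
            * poly (pderiv y) x
        + ((real m + real n) * poly (exc_S m \<alpha>) x - 2 * \<alpha> * poly (pderiv (exc_S m \<alpha>)) x)
            * poly y x = 0)"
  unfolding is_exc_laguerre_def
  by (intro conj_cong refl iff_allI imp_cong exc_ode_cleared)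

lemma is_exc_laguerre_exc_poly: "is_exc_laguerre m n \<alpha> (exc_poly m n \<alpha>)"
  unfolding is_exc_laguerre_iff
  by (intro conjI allI impI exc_poly_degree_lead exc_poly_ode)

text \<open>Comparing leading terms, a nonzero polynomial solution has degree exactly \<open>m + n\<close>;
  the difference of two normalised solutions has smaller degree, hence vanishes.\<close>

lemma is_exc_laguerre_unique:
  assumes y: "is_exc_laguerre m n \<alpha> y" and z: "is_exc_laguerre m n \<alpha> z"
  shows "y = z"
proof (rule ccontr)
  assume "y \<noteq> z"
  define d where "d = y - z"
  define S where "S = exc_S m \<alpha>"
  define N where "N = real m + real n"
  have "d \<noteq> 0" using \<open>y \<noteq> z\<close> by (simp add: d_def)
  have S: "S \<noteq> 0" "degree S = m"
    using lead_coeff_exc_S[of m \<alpha>] by (auto simp: S_def degree_exc_S)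
  have "degree d \<le> m + n" "coeff d (m + n) = 0"
    using y z by (auto simp: d_def is_exc_laguerre_def intro!: degree_diff_le)
  hence deg: "degree d < m + n"
    using \<open>d \<noteq> 0\<close> by (metis le_neq_implies_less leading_coeff_0_iff)
  define D where "D = degree d"
  \<comment> \<open>In these terms the cleared equation for \<open>d\<close> reads S * G = 2 * S' *
    H.\<close>
  define G where "G = pCons 0 (pderiv (pderiv d)) + smult (\<alpha> + 1) (pderiv d)
    - pCons 0 (pderiv d) + smult N d"
  define H where "H = pCons 0 (pderiv d) + smult \<alpha> d"
  define E where "E = S * G - smult 2 (pderiv S * H)"
  have "E = 0"
  proof (rule ccontr)
    assume "E \<noteq> 0"
    \<comment> \<open>The equation is known only away from 0 and the zeros of \<open>S\<close>; the
      factor \<open>S * [:0, 1:]\<close> takes care of these points.\<close>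
    hence "finite {x. poly (E * (S * [:0, 1:])) x = 0}"
      using S by (intro poly_roots_finite) auto
    moreover have "poly (E * (S * [:0, 1:])) x = 0" for x
    proof (cases "x = 0 \<or> poly S x = 0")
      case False
      define F where "F = (\<lambda>w. x * poly S x * poly (pderiv (pderiv w)) x
        + ((\<alpha> + 1 - x) * poly S x - 2 * x * poly (pderiv S) x) * poly (pderiv w) x
        + (N * poly S x - 2 * \<alpha> * poly (pderiv S) x) * poly w x)"
      have "F y = 0" "F z = 0"
        using y z False unfolding F_def is_exc_laguerre_iff S_def N_def by blast+
      moreover have "poly E x = F y - F z"
        by (simp add: E_def G_def H_def F_def d_def pderiv_diff algebra_simps)
      ultimately show ?thesis by simp
    qed auto
    ultimately have "finite (UNIV :: real set)" by (simp only: UNIV_def simp_thms)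
    thus False using infinite_UNIV_char_0 by blast
  qed
  hence SG: "S * G = smult 2 (pderiv S * H)" by (simp add: E_def)
  \<comment> \<open>Only - x * d' and \<open>N\<close> * d reach degree \<open>D\<close> in
    \<open>G\<close>. As \<open>D\<close> < m + n, this coefficient is nonzero, so S * G has degree
    at least m + D, which S' * H cannot attain.\<close>
  have "coeff G D = (N - real D) * lead_coeff d"
    by (cases D) (simp_all add: G_def D_def coeff_pCons coeff_pderiv coeff_eq_0 algebra_simps)
  moreover have "N - real D \<noteq> 0" using deg by (simp add: N_def D_def)
  ultimately have "coeff G D \<noteq> 0" using \<open>d \<noteq> 0\<close> by simp
  hence G: "G \<noteq> 0" "degree G \<ge> D" by (auto intro: le_degree)
  have H: "degree H \<le> D"
  proof -
    have "degree (pCons 0 (pderiv d)) \<le> D"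
      by (cases "pderiv d = 0") (auto simp: D_def degree_pderiv pderiv_eq_0_iff)
    thus ?thesis unfolding H_def D_def by (intro degree_add_le) auto
  qed
  show False
  proof (cases "m = 0")
    case True
    hence "pderiv S = 0" using S by (simp add: pderiv_eq_0_iff)
    thus False using SG G S by simp
  next
    case False
    have "m + D \<le> degree (S * G)" using S G by (simp add: degree_mult_eq)
    also have "\<dots> \<le> degree (pderiv S) + degree H"
      unfolding SG using degree_mult_le[of "pderiv S" H] degree_smult_le order_trans by blast
    also have "\<dots> < m + D" using H S False by (simp add: degree_pderiv)
    finally show False by simp
  qed
qed

lemma exc_laguerre_eq: "exc_laguerre m n \<alpha> = exc_poly m n \<alpha>"
  unfolding exc_laguerre_def
  using is_exc_laguerre_exc_poly is_exc_laguerre_unique by blast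

text \<open>At the zeros of the second Laguerre factor A, y equals - S * A' with S positive; at the
  zeros of S, y equals S' * A with A positive. So \<open>interlacing_roots\<close> applies on both
  half-lines. The negative zeros are given by their absolute values \<open>z i\<close>, in
  increasing order.\<close>

lemma exc_poly_zeros:
  assumes "\<alpha> > 0"
  obtains c z x where
    "strict_mono_on {..<m} c" "\<And>i. i < m \<Longrightarrow> c i > 0"
    "\<And>i. i < m \<Longrightarrow> poly (laguerre m (\<alpha> - 1)) (c i) = 0"
    "\<And>i. i < m \<Longrightarrow> c i < z i" "\<And>i. Suc i < m \<Longrightarrow> z i < c (Suc i)"
    "strict_mono_on {..<m} z" "\<And>i. i < m \<Longrightarrow> poly (exc_poly m n \<alpha>) (- z i) = 0"
    "strict_mono_on {..<n} x" "\<And>i. i < n \<Longrightarrow> x i > 0"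
    "\<And>i. i < n \<Longrightarrow> poly (exc_poly m n \<alpha>) (x i) = 0"
proof -
  let ?S = "exc_S m \<alpha>" and ?A = "laguerre n (\<alpha> - 1)" and ?L = "laguerre m (\<alpha> - 1)"
  let ?y = "exc_poly m n \<alpha>"
  obtain a where a: "strict_mono_on {..<n} a" "\<And>i. i < n \<Longrightarrow> a i > 0"
    "\<And>i. i < n \<Longrightarrow> poly ?A (a i) = 0"
    using laguerre_zeros[of "\<alpha> - 1" n] assms by auto
  obtain c where c: "strict_mono_on {..<m} c" "\<And>i. i < m \<Longrightarrow> c i > 0"
    "\<And>i. i < m \<Longrightarrow> poly ?L (c i) = 0"
    using laguerre_zeros[of "\<alpha> - 1" m] assms by auto
  have simple: "poly (pderiv (laguerre k (\<alpha> - 1))) (b i) \<noteq> 0"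
    if "strict_mono_on {..<k} b" "\<And>i. i < k \<Longrightarrow> poly (laguerre k (\<alpha> - 1)) (b i) = 0" "i < k"
    for b k i
  proof -
    have "inj_on b {..<k}" using that(1) strict_mono_on_imp_inj_on by blast
    with that show ?thesis
      by (subst pderiv_at_root(1)[of "b ` {..<k}"])
         (auto simp: card_image degree_laguerre coeff_laguerre)
  qed
  have pos: "poly (laguerre k (\<alpha> - 1)) t > 0"
    if "strict_mono_on {..<k} b" "\<And>i. i < k \<Longrightarrow> poly (laguerre k (\<alpha> - 1)) (b i) = 0"
      "\<And>i. i < k \<Longrightarrow> b i > 0" "t \<le> 0" for b k t
  proof -
    have "b i - t > 0" if "i < k" for i using \<open>i < k \<Longrightarrow> b i > 0\<close> that \<open>t \<le> 0\<close> by linarith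
    hence "(\<Prod>i<k. b i - t) > 0" by (intro prod_pos) auto
    thus ?thesis using laguerre_eq_prod[OF that(1,2)] by simp
  qed
  have S': "poly (pderiv ?S) x = - poly (pderiv ?L) (- x)" for x
    by (simp add: exc_S_def pderiv_pcompose pderiv_pCons poly_pcompose)
  have "poly ?y (a i) * poly (pderiv ?A) (a i) < 0" if i: "i < n" for i
  proof -
    have "poly ?S (a i) * (poly (pderiv ?A) (a i))\<^sup>2 > 0"
      using pos[OF c(1,3,2), of "- a i"] a(2)[OF i] simple[OF a(1,3) i]
      by (simp add: poly_exc_S)
    thus ?thesis using a(3)[OF i] by (simp add: poly_exc_poly power2_eq_square algebra_simps)
  qed
  moreover have "lead_coeff ?y * lead_coeff ?A > 0"
    unfolding exc_poly_degree_lead(2) lead_coeff_laguerre by (simp flip: power_mult_distrib)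
  ultimately obtain x where x: "strict_mono_on {..<n} x" "\<And>i. i < n \<Longrightarrow> poly ?y (x i) = 0"
    "\<And>i. i < n \<Longrightarrow> a i < x i"
    using interlacing_roots[OF a(1) degree_laguerre a(3), of ?y] by metis
  \<comment> \<open>Reflection moves the negative zeros to the positive half-line, where
    \<open>?L\<close> plays the part of \<open>q\<close>.\<close>
  define r where "r = pcompose ?y [:0, -1:]"
  have "poly r (c i) * poly (pderiv ?L) (c i) < 0" if i: "i < m" for i
  proof -
    have "poly ?A (- c i) * (poly (pderiv ?L) (c i))\<^sup>2 > 0"
      using pos[OF a(1,3,2), of "- c i"] c(2)[OF i] simple[OF c(1,3) i] by simp
    thus ?thesis using c(3)[OF i]
      by (simp add: r_def poly_pcompose poly_exc_poly poly_exc_S S' power2_eq_square algebra_simps)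
  qed
  moreover have "lead_coeff r * lead_coeff ?L > 0"
  proof -
    have "lead_coeff r = lead_coeff ?y * (-1) ^ degree ?y"
      unfolding r_def by (subst lead_coeff_comp) simp_all
    also have "\<dots> = (-1) ^ n / (fact m * fact n) * (-1) ^ (m + n)"
      unfolding exc_poly_degree_lead(2) by (simp only: exc_poly_degree_lead(1))
    also have "\<dots> = (-1) ^ m / (fact m * fact n)"
      by (simp add: power_add flip: power_mult_distrib mult.assoc)
    finally show ?thesis
      by (simp add: lead_coeff_laguerre flip: power_mult_distrib)
  qed
  ultimately obtain z where z: "strict_mono_on {..<m} z" "\<And>i. i < m \<Longrightarrow> poly r (z i) = 0"
    "\<And>i. i < m \<Longrightarrow> c i < z i" "\<And>i. Suc i < m \<Longrightarrow> z i < c (Suc i)"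
    using interlacing_roots[OF c(1) degree_laguerre c(3), of r] by metis
  show ?thesis
  proof (rule that[OF c z(3,4,1) _ x(1) _ x(2)])
    show "poly ?y (- z i) = 0" if "i < m" for i
      using z(2)[OF that] by (simp add: r_def poly_pcompose)
    show "x i > 0" if "i < n" for i using a(2) x(3) that less_trans by blast
  qed
qed

section \<open>Maximality of the logarithmic energy\<close>

text \<open>For \<phi> = ln v this is the logarithm of the product functional on distinct points:
  ordered pairs count each difference twice, which matches the squares. It is to be
  maximised.\<close>

definition log_energy :: "(real \<Rightarrow> real) \<Rightarrow> real set \<Rightarrow> real" where
  "log_energy \<phi> F = (\<Sum>x\<in>F. \<phi> x) + (\<Sum>x\<in>F. \<Sum>y\<in>F - {x}. ln \<bar>x - y\<bar>)"

lemma ordered_enumeration: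
  fixes F :: "'a :: linorder set"
  assumes "finite F"
  obtains f where "bij_betw f {..<card F} F" "strict_mono_on {..<card F} f"
proof
  show "bij_betw (\<lambda>i. sorted_list_of_set F ! i) {..<card F} F"
    using assms by (intro bij_betw_nth) auto
  show "strict_mono_on {..<card F} (\<lambda>i. sorted_list_of_set F ! i)"
    using assms strict_sorted_list_of_set[of F]
    by (auto simp: strict_mono_on_def sorted_wrt_iff_nth_less)
qed

text \<open>Matching in increasing order keeps every quotient (h x - h y) / (x - y) positive, so
  that its logarithm can be estimated.\<close>

lemma ordered_bijection:
  fixes X F :: "'a :: linorder set"
  assumes "finite X" "finite F" "card F = card X"
  obtains h where "bij_betw h X F" "strict_mono_on X h"
proof -
  obtain x where x: "bij_betw x {..<card X} X" "strict_mono_on {..<card X} x"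
    using ordered_enumeration[OF assms(1)] .
  obtain f where f: "bij_betw f {..<card X} F" "strict_mono_on {..<card X} f"
    using ordered_enumeration[OF assms(2)] assms(3) by metis
  define g where "g = the_inv_into {..<card X} x"
  have g: "bij_betw g X {..<card X}"
    unfolding g_def by (rule bij_betw_the_inv_into[OF x(1)])
  have "strict_mono_on X (f \<circ> g)"
  proof (rule strict_mono_onI)
    fix a b assume ab: "a \<in> X" "b \<in> X" "a < b"
    have gx: "x (g a) = a" "x (g b) = b"
      using ab x(1) by (auto simp: g_def bij_betw_def intro!: f_the_inv_into_f)
    have mem: "g a \<in> {..<card X}" "g b \<in> {..<card X}"
      using ab g bij_betwE by blast+
    have "g a < g b"
      using strict_mono_on_less[OF x(2) mem] gx ab(3) by simp
    thus "(f \<circ> g) a < (f \<circ> g) b" using strict_mono_onD[OF f(2) mem] by simp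
  qed
  with bij_betw_trans[OF g f(1)] show ?thesis by (rule that)
qed

lemma sum_swap_off_diagonal:
  assumes "finite X"
  shows "(\<Sum>x\<in>X. \<Sum>y\<in>X - {x}. g x y) = (\<Sum>x\<in>X. \<Sum>y\<in>X - {x}. g y x)"
proof -
  have *: "X - {x} = {y \<in> X. x \<noteq> y}" for x by auto
  show ?thesis unfolding * by (subst sum.swap_restrict[OF assms assms]) (simp add: eq_commute)
qed

text \<open>Both parts of the energy are bounded by their linearisations at \<open>X\<close> along
  the increasing matching; by \<open>crit\<close> the linear terms add up to zero.\<close>

lemma log_energy_less:
  fixes \<phi> D :: "real \<Rightarrow> real"
  assumes X: "finite X" and F: "finite F" "card F = card X" "F \<noteq> X"
    and tangent: "\<And>x u. x \<in> X \<Longrightarrow> u \<in> F \<Longrightarrow> u \<noteq> x \<Longrightarrow> \<phi> u - \<phi> x < D x * (u - x)"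
    and crit: "\<And>x. x \<in> X \<Longrightarrow> D x + 2 * (\<Sum>y\<in>X - {x}. 1 / (x - y)) = 0"
  shows "log_energy \<phi> F < log_energy \<phi> X"
proof -
  obtain h where h: "bij_betw h X F" "strict_mono_on X h"
    using ordered_bijection[OF X F(1,2)] .
  define d where "d = (\<lambda>x. h x - x)"
  have inj: "inj_on h X" and im: "F = h ` X" using h(1) by (auto simp: bij_betw_def)
  have img: "F - {h x} = h ` (X - {x})" if "x \<in> X" for x
    unfolding im using that by (subst inj_on_image_set_diff[OF inj]) auto
  have sub: "inj_on h (X - {x})" for x using inj by (rule inj_on_subset) auto
  have "log_energy \<phi> F = (\<Sum>x\<in>X. \<phi> (h x)) + (\<Sum>x\<in>X. \<Sum>y\<in>F - {h x}. ln \<bar>h x - y\<bar>)"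
    unfolding log_energy_def using inj by (simp add: im sum.reindex)
  also have "(\<Sum>x\<in>X. \<Sum>y\<in>F - {h x}. ln \<bar>h x - y\<bar>) = (\<Sum>x\<in>X. \<Sum>y\<in>X - {x}. ln \<bar>h x - h y\<bar>)"
    by (rule sum.cong[OF refl]) (simp add: img sum.reindex[OF sub])
  finally have EF: "log_energy \<phi> F =
    (\<Sum>x\<in>X. \<phi> (h x)) + (\<Sum>x\<in>X. \<Sum>y\<in>X - {x}. ln \<bar>h x - h y\<bar>)" .
  \<comment> \<open>Some point moves, and there the tangent inequality is strict.\<close>
  obtain x0 where x0: "x0 \<in> X" "h x0 \<noteq> x0" using F(3) im by force
  have "\<phi> (h x) - \<phi> x \<le> D x * d x" if "x \<in> X" for x
    using tangent[OF that, of "h x"] that im by (cases "h x = x") (auto simp: d_def)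
  moreover have "\<phi> (h x0) - \<phi> x0 < D x0 * d x0"
    using tangent[OF x0(1), of "h x0"] x0 im by (auto simp: d_def)
  ultimately have 1: "(\<Sum>x\<in>X. \<phi> (h x) - \<phi> x) < (\<Sum>x\<in>X. D x * d x)"
    using x0(1) by (intro sum_strict_mono_ex1[OF X]) auto
  \<comment> \<open>This is ln r \<le> r - 1 for r = (h x - h y) / (x - y).\<close>
  have "ln \<bar>h x - h y\<bar> - ln \<bar>x - y\<bar> \<le> (d x - d y) / (x - y)"
    if xy: "x \<in> X" "y \<in> X" "x \<noteq> y" for x y
  proof -
    have "(h x - h y) / (x - y) > 0"
      using strict_mono_onD[OF h(2) xy(1,2)] strict_mono_onD[OF h(2) xy(2,1)] xy(3)
      by (cases "x < y") (auto intro: divide_neg_neg divide_pos_pos)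
    hence "ln ((h x - h y) / (x - y)) \<le> (h x - h y) / (x - y) - 1"
      by (rule ln_le_minus_one)
    also have "(h x - h y) / (x - y) = \<bar>h x - h y\<bar> / \<bar>x - y\<bar>"
      using \<open>(h x - h y) / (x - y) > 0\<close> by (metis abs_divide abs_of_pos)
    also have "ln (\<bar>h x - h y\<bar> / \<bar>x - y\<bar>) = ln \<bar>h x - h y\<bar> - ln \<bar>x - y\<bar>"
      using xy inj by (auto simp: ln_div inj_on_def)
    also have "\<bar>h x - h y\<bar> / \<bar>x - y\<bar> = (h x - h y) / (x - y)"
      using \<open>(h x - h y) / (x - y) > 0\<close> by (metis abs_divide abs_of_pos)
    also have "(h x - h y) / (x - y) - 1 = (d x - d y) / (x - y)"
      using xy(3) by (simp add: d_def field_simps)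
    finally show ?thesis .
  qed
  hence "(\<Sum>x\<in>X. \<Sum>y\<in>X - {x}. ln \<bar>h x - h y\<bar> - ln \<bar>x - y\<bar>)
      \<le> (\<Sum>x\<in>X. \<Sum>y\<in>X - {x}. (d x - d y) / (x - y))"
    by (intro sum_mono) auto
  also have "\<dots> = (\<Sum>x\<in>X. \<Sum>y\<in>X - {x}. d x / (x - y)) + (\<Sum>x\<in>X. \<Sum>y\<in>X - {x}. d y / (y - x))"
  proof -
    have "(d x - d y) / (x - y) = d x / (x - y) + d y / (y - x)" for x y
      by (simp add: diff_divide_distrib) (metis minus_diff_eq minus_divide_right)
    thus ?thesis by (simp add: sum.distrib)
  qed
  \<comment> \<open>Exchanging the roles of x and y identifies the two double sums, whence the
    factor 2.\<close>
  also have "\<dots> = (\<Sum>x\<in>X. d x * (2 * (\<Sum>y\<in>X - {x}. 1 / (x - y))))"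
    by (subst sum_swap_off_diagonal[OF X, of "\<lambda>x y. d y / (y - x)"])
       (simp add: sum_distrib_left mult.commute flip: sum.distrib)
  finally have 2: "(\<Sum>x\<in>X. \<Sum>y\<in>X - {x}. ln \<bar>h x - h y\<bar> - ln \<bar>x - y\<bar>) \<le> \<dots>" .
  have "(\<Sum>x\<in>X. D x * d x) + (\<Sum>x\<in>X. d x * (2 * (\<Sum>y\<in>X - {x}. 1 / (x - y)))) =
      (\<Sum>x\<in>X. d x * (D x + 2 * (\<Sum>y\<in>X - {x}. 1 / (x - y))))"
    by (simp add: algebra_simps flip: sum.distrib)
  also have "\<dots> = 0" using crit by simp
  finally show ?thesis
    using 1 2 unfolding EF log_energy_def[of \<phi> X] by (simp add: sum_subtractf)
qed

section \<open>Strict concavity of the logarithm of the weight\<close>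

lemma ln_tangent_gap_nonpos:
  fixes x u t :: real
  assumes "x + t > 0" "u + t > 0"
  shows "ln (u + t) - ln (x + t) - (u - x) / (x + t) \<le> 0"
proof -
  have "ln ((u + t) / (x + t)) \<le> (u + t) / (x + t) - 1"
    using assms by (intro ln_le_minus_one) simp
  also have "(u + t) / (x + t) - 1 = (u - x) / (x + t)"
    using assms by (simp add: field_simps)
  finally show ?thesis using assms by (simp add: ln_div)
qed

text \<open>The logarithm flattens to the right, so its gap below the tangent shrinks. A single use
  of ln r \<le> r - 1, with r a cross ratio of the four shifted points, compares both gaps.\<close>

lemma ln_tangent_gap_strict_mono:
  fixes x u s t :: real
  assumes "x + s > 0" "u + s > 0" "s < t" "u \<noteq> x"
  shows "ln (u + s) - ln (x + s) - (u - x) / (x + s) < ln (u + t) - ln (x + t) - (u - x) / (x + t)"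
proof -
  have pos: "x + t > 0" "u + t > 0" using assms by auto
  let ?r = "((u + s) * (x + t)) / ((x + s) * (u + t))"
  have "ln (u + s) - ln (x + s) - ln (u + t) + ln (x + t) = ln ?r"
    using assms pos by (simp add: ln_div ln_mult)
  also have "\<dots> \<le> ?r - 1"
    using assms pos by (intro ln_le_minus_one) simp
  \<comment> \<open>Exact evaluation of r - 1; the remainder contains (u - x)^2 * (t - s) and
    provides the strictness.\<close>
  also have "\<dots> = (u - x) / (x + s) - (u - x) / (x + t)
      - (u - x)\<^sup>2 * (t - s) / ((x + s) * (x + t) * (u + t))"
    using assms pos by (simp add: divide_simps power2_eq_square) (simp add: algebra_simps)
  also have "\<dots> < (u - x) / (x + s) - (u - x) / (x + t)"
    using assms pos by simp
  finally show ?thesis by simp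
qed

text \<open>From 0 < c 0 < z 0 < c 1 < ... each c-term outweighs the term just before it, and only
  \<open>f (z k)\<close> remains unpaired.\<close>

lemma interlacing_gap_sum:
  fixes f :: "real \<Rightarrow> real"
  assumes mono: "\<And>s t. 0 \<le> s \<Longrightarrow> s < t \<Longrightarrow> f s < f t"
    and c: "\<And>i. i \<le> k \<Longrightarrow> 0 < c i" "\<And>i. i \<le> k \<Longrightarrow> c i < z i"
    and cz: "\<And>i. i < k \<Longrightarrow> z i < c (Suc i)"
  shows "f 0 + (\<Sum>i<Suc k. f (z i)) - (\<Sum>i<Suc k. f (c i)) < f (z k)"
  using c cz
proof (induction k)
  case 0
  thus ?case using mono[of 0 "c 0"] by simp
next
  case (Suc k)
  have "z k \<ge> 0" using Suc.prems(1,2)[of k] by simp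
  hence "f (z k) < f (c (Suc k))" using Suc.prems(3)[of k] by (intro mono) auto
  moreover have "f 0 + (\<Sum>i<Suc k. f (z i)) - (\<Sum>i<Suc k. f (c i)) < f (z k)"
    using Suc.prems by (intro Suc.IH) auto
  ultimately show ?case by simp
qed

text \<open>The term \<open>2 * ln x\<close>, available because
  \<open>\<alpha> + 1 \<ge> 2\<close>, is paired with \<open>ln (x + c 0)\<close> and each \<open>ln (x + z i)\<close> with \<open>ln (x + c (Suc i))\<close>.\<close>

lemma log_weight_tangent:
  fixes \<alpha> x u :: real and m :: nat and c z :: "nat \<Rightarrow> real"
  assumes m: "m \<ge> 1" and \<alpha>: "\<alpha> \<ge> 1"
    and c: "\<And>i. i < m \<Longrightarrow> 0 < c i" "\<And>i. i < m \<Longrightarrow> c i < z i"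
      "\<And>i. Suc i < m \<Longrightarrow> z i < c (Suc i)"
    and pos: "x > 0" "u > 0" "u \<noteq> x"
  defines "\<phi> \<equiv> \<lambda>x. (\<alpha> + 1) * ln x - x + 2 * (\<Sum>i<m. ln (x + z i) - ln (x + c i))"
  defines "D \<equiv> \<lambda>x. (\<alpha> + 1) / x - 1 + 2 * (\<Sum>i<m. 1 / (x + z i) - 1 / (x + c i))"
  shows "\<phi> u - \<phi> x < D x * (u - x)"
proof -
  define f where "f = (\<lambda>t. ln (u + t) - ln (x + t) - (u - x) / (x + t))"
  obtain k where k: "m = Suc k" using m by (cases m) auto
  have f0: "f t \<le> 0" if "t \<ge> 0" for t
    unfolding f_def using that pos by (intro ln_tangent_gap_nonpos) auto
  have "f 0 + (\<Sum>i<Suc k. f (z i)) - (\<Sum>i<Suc k. f (c i)) < f (z k)"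
  proof (rule interlacing_gap_sum)
    show "f s < f t" if "0 \<le> s" "s < t" for s t
      unfolding f_def using that pos by (intro ln_tangent_gap_strict_mono) auto
  qed (use c k in auto)
  moreover have "f (z k) \<le> 0" using c(1,2)[of k] k by (intro f0) auto
  ultimately have 1: "f 0 + (\<Sum>i<m. f (z i) - f (c i)) < 0"
    by (simp add: k sum_subtractf)
  \<comment> \<open>Here \<alpha> \<ge> 1 enters: two copies of \<open>f 0\<close> go with the
    doubled sum, and the remaining multiple is nonpositive.\<close>
  have "(\<alpha> - 1) * f 0 \<le> 0" using \<alpha> f0[of 0] by (simp add: mult_nonneg_nonpos)
  moreover have "\<phi> u - \<phi> x - D x * (u - x) = (\<alpha> + 1) * f 0 + 2 * (\<Sum>i<m. f (z i) - f (c i))"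
    using pos unfolding \<phi>_def D_def f_def
    by (simp add: algebra_simps sum.distrib sum_subtractf sum_distrib_left sum_distrib_right
      diff_divide_distrib add_divide_distrib)
  moreover have "(\<alpha> + 1) * f 0 = (\<alpha> - 1) * f 0 + 2 * f 0" by (simp add: algebra_simps)
  ultimately show ?thesis using 1 by linarith
qed

section \<open>Energy and the product functional\<close>

text \<open>Each unordered pair occurs in both orders; the induction step adds the last row and
  column.\<close>

lemma sum_off_diagonal_sym:
  fixes f :: "nat \<Rightarrow> nat \<Rightarrow> real"
  assumes "\<And>i j. f i j = f j i"
  shows "(\<Sum>j\<in>{1..n}. \<Sum>i\<in>{1..n} - {j}. f j i) = (\<Sum>j\<in>{1..n}. \<Sum>i\<in>{1..<j}. 2 * f i j)"
proof (induction n)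
  case (Suc n)
  have "(\<Sum>i\<in>{1..Suc n} - {j}. f j i) = (\<Sum>i\<in>{1..n} - {j}. f j i) + f (Suc n) j"
    if "j \<in> {1..n}" for j
  proof -
    have "{1..Suc n} - {j} = insert (Suc n) ({1..n} - {j})" using that by auto
    thus ?thesis using assms[of j "Suc n"] by simp
  qed
  hence "(\<Sum>j\<in>{1..n}. \<Sum>i\<in>{1..Suc n} - {j}. f j i) =
      (\<Sum>j\<in>{1..n}. \<Sum>i\<in>{1..n} - {j}. f j i) + (\<Sum>j\<in>{1..n}. f (Suc n) j)"
    by (simp add: sum.distrib)
  moreover have "{1..Suc n} - {Suc n} = {1..n}" "{1..<Suc n} = {1..n}" by auto
  moreover have "f i (Suc n) = f (Suc n) i" for i by (rule assms)
  ultimately show ?case using Suc.IH by (simp add: sum_distrib_left)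
qed auto

text \<open>Injectivity makes every factor positive, so the logarithm of the product may be taken
  factor by factor.\<close>

lemma fekete_T_eq_exp:
  assumes inj: "inj_on u {1..n}" and v: "\<And>j. j \<in> {1..n} \<Longrightarrow> v (u j) > 0"
  shows "fekete_T v n u = exp (log_energy (\<lambda>x. ln (v x)) (u ` {1..n}))"
proof -
  let ?J = "{1..n}"
  have ne: "u i \<noteq> u j" if "j \<in> ?J" "i \<in> {1..<j}" for i j
    using inj_onD[OF inj, of i j] that by auto
  have inner: "(\<Prod>i\<in>{1..<j}. (u i - u j)\<^sup>2) > 0" if "j \<in> ?J" for j
    using ne[OF that] by (intro prod_pos) auto
  have P: "(\<Prod>j\<in>?J. v (u j)) > 0" "(\<Prod>j\<in>?J. \<Prod>i\<in>{1..<j}. (u i - u j)\<^sup>2) > 0"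
    by (rule prod_pos, erule v) (rule prod_pos, erule inner)
  have img: "u ` ?J - {u j} = u ` (?J - {j})" if "j \<in> ?J" for j
    using that by (subst inj_on_image_set_diff[OF inj]) auto
  have sub: "inj_on u (?J - {j})" for j using inj by (rule inj_on_subset) auto
  have "log_energy (\<lambda>x. ln (v x)) (u ` ?J) =
      (\<Sum>j\<in>?J. ln (v (u j))) + (\<Sum>j\<in>?J. \<Sum>y\<in>u ` ?J - {u j}. ln \<bar>u j - y\<bar>)"
    unfolding log_energy_def using inj by (simp add: sum.reindex)
  also have "(\<Sum>j\<in>?J. \<Sum>y\<in>u ` ?J - {u j}. ln \<bar>u j - y\<bar>) =
      (\<Sum>j\<in>?J. \<Sum>i\<in>?J - {j}. ln \<bar>u j - u i\<bar>)"
    by (rule sum.cong[OF refl]) (simp only: img sum.reindex[OF sub] comp_def)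
  also have "\<dots> = (\<Sum>j\<in>?J. \<Sum>i\<in>{1..<j}. 2 * ln \<bar>u i - u j\<bar>)"
    by (rule sum_off_diagonal_sym) (simp add: abs_minus_commute)
  also have "\<dots> = (\<Sum>j\<in>?J. ln (\<Prod>i\<in>{1..<j}. (u i - u j)\<^sup>2))"
  proof (intro sum.cong refl)
    fix j assume j: "j \<in> ?J"
    have "ln ((u i - u j)\<^sup>2) = 2 * ln \<bar>u i - u j\<bar>" if "i \<in> {1..<j}" for i
      using ne[OF j that] ln_realpow[of "\<bar>u i - u j\<bar>" 2] by simp
    thus "(\<Sum>i\<in>{1..<j}. 2 * ln \<bar>u i - u j\<bar>) = ln (\<Prod>i\<in>{1..<j}. (u i - u j)\<^sup>2)"
      using ne[OF j] by (subst ln_prod) auto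
  qed
  also have "\<dots> = ln (\<Prod>j\<in>?J. \<Prod>i\<in>{1..<j}. (u i - u j)\<^sup>2)"
    by (rule ln_prod[symmetric, OF finite_atLeastAtMost]) (use inner in \<open>metis less_irrefl\<close>)
  also have "(\<Sum>j\<in>?J. ln (v (u j))) = ln (\<Prod>j\<in>?J. v (u j))"
    by (rule ln_prod[symmetric, OF finite_atLeastAtMost]) (use v in \<open>metis less_irrefl\<close>)
  finally have "log_energy (\<lambda>x. ln (v x)) (u ` ?J) = ln (fekete_T v n u)"
    unfolding fekete_T_def by (simp only: ln_mult_pos[OF P])
  moreover have "fekete_T v n u > 0" unfolding fekete_T_def using P by simp
  ultimately show ?thesis by simp
qed

lemma fekete_T_eq_0:
  assumes "\<not> inj_on u {1..n}"
  shows "fekete_T v n u = 0"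
proof -
  obtain i j where "i \<in> {1..n}" "j \<in> {1..n}" "i < j" "u i = u j"
    using assms by (metis inj_on_def linorder_neqE_nat)
  hence "(\<Prod>j\<in>{1..n}. \<Prod>i\<in>{1..<j}. (u i - u j)\<^sup>2) = 0" by force
  thus ?thesis by (simp add: fekete_T_def)
qed

text \<open>Each point lies in 2 (n - 1) ordered pairs, and the exponent 1 / (2 (n - 1)) restores
  exactly one factor \<open>v x\<close> per point.\<close>

lemma weighted_energy_eq:
  assumes F: "finite F" "card F = n" and n: "n \<ge> 2" and v: "\<And>x. x \<in> F \<Longrightarrow> v x > 0"
  shows "weighted_energy (\<lambda>x. v x powr (1 / (2 * (real n - 1)))) F =
    - log_energy (\<lambda>x. ln (v x)) F"
proof -
  define g where "g = (\<lambda>x. ln (v x) / (2 * (real n - 1)))"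
  have "ln (1 / (\<bar>x - y\<bar> * v x powr (1 / (2 * (real n - 1))) * v y powr (1 / (2 * (real n - 1))))) =
      - (ln \<bar>x - y\<bar> + (g x + g y))" if "x \<in> F" "y \<in> F - {x}" for x y
    using v[of x] v[of y] that by (simp add: ln_div ln_mult ln_powr g_def)
  hence "weighted_energy (\<lambda>x. v x powr (1 / (2 * (real n - 1)))) F =
      (\<Sum>x\<in>F. \<Sum>y\<in>F - {x}. - (ln \<bar>x - y\<bar> + (g x + g y)))"
    unfolding weighted_energy_def by (intro sum.cong refl) auto
  also have "\<dots> = - (\<Sum>x\<in>F. \<Sum>y\<in>F - {x}. ln \<bar>x - y\<bar>) - (\<Sum>x\<in>F. \<Sum>y\<in>F - {x}. g x + g y)"
    by (simp add: sum.distrib sum_negf sum_subtractf)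
  also have "(\<Sum>x\<in>F. \<Sum>y\<in>F - {x}. g x + g y) = (\<Sum>x\<in>F. (real n - 2) * g x + sum g F)"
  proof (intro sum.cong refl)
    fix x assume x: "x \<in> F"
    hence "(\<Sum>y\<in>F - {x}. g y) = sum g F - g x" using F by (simp add: sum_diff1)
    moreover have "real (card (F - {x})) = real n - 1" using F x n by (simp add: of_nat_diff)
    moreover have "(\<Sum>y\<in>F - {x}. g x + g y) =
        real (card (F - {x})) * g x + (\<Sum>y\<in>F - {x}. g y)"
      by (simp add: sum.distrib)
    ultimately have "(\<Sum>y\<in>F - {x}. g x + g y) = (real n - 1) * g x + (sum g F - g x)"
      by (simp only:)
    thus "(\<Sum>y\<in>F - {x}. g x + g y) = (real n - 2) * g x + sum g F"
      by (simp add: algebra_simps)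
  qed
  also have "\<dots> = (real n - 2) * sum g F + real n * sum g F"
    using F by (simp add: sum.distrib sum_distrib_left)
  also have "\<dots> = 2 * (real n - 1) * sum g F" by (simp add: algebra_simps)
  also have "\<dots> = (\<Sum>x\<in>F. ln (v x))"
    using n by (simp add: g_def sum_distrib_left)
  finally show ?thesis by (simp add: log_energy_def)
qed

section \<open>Optimality of the regular zeros\<close>

text \<open>\<open>log_weight_tangent\<close> and the differential equation supply the two
  hypotheses \<open>tangent\<close> and \<open>crit\<close> of
  \<open>log_energy_less\<close>.\<close>

lemma regular_zeros_optimal:
  fixes m n :: nat and \<alpha> :: real
  assumes m: "m \<ge> 1" and \<alpha>: "\<alpha> \<ge> 1"
  defines "v \<equiv> exc_v m n \<alpha>" and "X \<equiv> regular_zeros m n \<alpha>"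
  shows "finite X" "card X = n" "X \<subseteq> {0<..}" "\<And>t. t > 0 \<Longrightarrow> v t > 0"
    and "\<And>F. finite F \<Longrightarrow> card F = n \<Longrightarrow> F \<subseteq> {0<..} \<Longrightarrow> F \<noteq> X \<Longrightarrow>
      log_energy (\<lambda>t. ln (v t)) F < log_energy (\<lambda>t. ln (v t)) X"
proof -
  obtain c z x where c: "strict_mono_on {..<m} c" "\<And>i. i < m \<Longrightarrow> c i > 0"
      "\<And>i. i < m \<Longrightarrow> poly (laguerre m (\<alpha> - 1)) (c i) = 0"
    and cz: "\<And>i. i < m \<Longrightarrow> c i < z i" "\<And>i. Suc i < m \<Longrightarrow> z i < c (Suc i)"
    and z: "strict_mono_on {..<m} z" "\<And>i. i < m \<Longrightarrow> poly (exc_poly m n \<alpha>) (- z i) = 0"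
    and x: "strict_mono_on {..<n} x" "\<And>i. i < n \<Longrightarrow> x i > 0"
      "\<And>i. i < n \<Longrightarrow> poly (exc_poly m n \<alpha>) (x i) = 0"
    using exc_poly_zeros[of \<alpha> m n] \<alpha> by auto
  have zpos: "z i > 0" if "i < m" for i using c(2) cz(1) that less_trans by blast
  let ?y = "exc_poly m n \<alpha>" and ?S = "exc_S m \<alpha>"
  define Z where "Z = (\<lambda>i. - z i) ` {..<m}"
  define C where "C = (\<lambda>i. - c i) ` {..<m}"
  \<comment> \<open>These are already m + n zeros, hence all of them; their signs then separate
    regular from exceptional ones.\<close>
  define R where "R = x ` {..<n} \<union> Z"
  have injx: "inj_on x {..<n}" using x(1) strict_mono_on_imp_inj_on by blast
  have injz: "inj_on (\<lambda>i. - z i) {..<m}"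
    using strict_mono_on_imp_inj_on[OF z(1)] by (simp add: inj_on_def)
  have injc: "inj_on (\<lambda>i. - c i) {..<m}"
    using strict_mono_on_imp_inj_on[OF c(1)] by (simp add: inj_on_def)
  have xpos: "t > 0" if "t \<in> x ` {..<n}" for t using that x(2) by auto
  have Zneg: "t < 0" if "t \<in> Z" for t using that zpos by (auto simp: Z_def)
  have disj: "x ` {..<n} \<inter> Z = {}" using xpos Zneg by (meson disjoint_iff less_asym)
  have R: "finite R" "card R = degree ?y"
    using disj injx injz
    by (simp_all add: R_def Z_def card_Un_disjoint card_image exc_poly_degree_lead)
  have Rroot: "poly ?y r = 0" if "r \<in> R" for r using that x(3) z(2) by (auto simp: R_def Z_def)
  have lead: "lead_coeff ?y \<noteq> 0" unfolding exc_poly_degree_lead(2) by simp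
  have roots: "poly ?y t = 0 \<longleftrightarrow> t \<in> R" for t
    using poly_eq_prod_roots'[OF R Rroot, of t] lead R(1) by auto
  have X: "X = x ` {..<n}"
    using xpos Zneg by (fastforce simp: X_def regular_zeros_def exc_laguerre_eq roots R_def)
  have EZ: "exceptional_zeros m n \<alpha> = Z"
    using xpos Zneg by (fastforce simp: exceptional_zeros_def exc_laguerre_eq roots R_def)
  show fin: "finite X" and card: "card X = n" and Xpos: "X \<subseteq> {0<..}"
    using injx xpos by (auto simp: X card_image)
  have P: "exc_P m n \<alpha> t = (\<Prod>i<m. t + z i) / fact m" for t
    unfolding exc_P_def EZ Z_def using injz by (simp add: prod.reindex)
  have S: "poly ?S t = (\<Prod>i<m. t + c i) / fact m" for t
    using laguerre_eq_prod[OF c(1,3), of "- t"] by (simp add: poly_exc_S add.commute)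
  have prods: "(\<Prod>i<m. t + z i) > 0" "(\<Prod>i<m. t + c i) > 0" if "t > 0" for t
    using that zpos c(2) by (auto intro!: prod_pos add_pos_pos)
  have v: "v t = t powr (\<alpha> + 1) * exp (- t) * ((\<Prod>i<m. t + z i) / (\<Prod>i<m. t + c i))\<^sup>2" for t
    by (simp add: v_def exc_v_def P S power_divide)
  show vpos: "v t > 0" if "t > 0" for t
    unfolding v using that
    by (intro mult_pos_pos zero_less_power divide_pos_pos prods) simp_all
  have lnv: "ln (v t) = (\<alpha> + 1) * ln t - t + 2 * (\<Sum>i<m. ln (t + z i) - ln (t + c i))"
    if "t > 0" for t
  proof -
    have pz: "t + z i \<noteq> 0" and pc: "t + c i \<noteq> 0" if "i < m" for i
      using that zpos[of i] c(2)[of i] \<open>t > 0\<close> by auto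
    have pe: "t powr (\<alpha> + 1) > 0" "exp (- t) > 0" using that by simp_all
    have q: "((\<Prod>i<m. t + z i) / (\<Prod>i<m. t + c i))\<^sup>2 > 0"
      using divide_pos_pos[OF prods[OF that]] by (rule zero_less_power)
    have "ln (v t) = ln (t powr (\<alpha> + 1)) + ln (exp (- t))
        + ln (((\<Prod>i<m. t + z i) / (\<Prod>i<m. t + c i))\<^sup>2)"
      unfolding v ln_mult_pos[OF mult_pos_pos[OF pe] q] ln_mult_pos[OF pe] ..
    also have "ln (((\<Prod>i<m. t + z i) / (\<Prod>i<m. t + c i))\<^sup>2) =
        2 * (ln (\<Prod>i<m. t + z i) - ln (\<Prod>i<m. t + c i))"
      by (simp only: ln_realpow ln_divide_pos[OF prods[OF that]] of_nat_numeral)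
    also have "ln (\<Prod>i<m. t + z i) = (\<Sum>i<m. ln (t + z i))"
      using pz by (intro ln_prod) auto
    also have "ln (\<Prod>i<m. t + c i) = (\<Sum>i<m. ln (t + c i))"
      using pc by (intro ln_prod) auto
    finally show ?thesis using that by (simp add: ln_powr sum_subtractf)
  qed
  define D where "D = (\<lambda>t. (\<alpha> + 1) / t - 1 + 2 * (\<Sum>i<m. 1 / (t + z i) - 1 / (t + c i)))"
  have crit: "D t + 2 * (\<Sum>r\<in>X - {t}. 1 / (t - r)) = 0" if "t \<in> X" for t
  proof -
    have t: "t > 0" "t \<in> R" using that Xpos by (auto simp: R_def X)
    have St: "poly ?S t \<noteq> 0" unfolding S using divide_pos_pos[OF prods(2)[OF t(1)] fact_gt_zero] by (metis less_irrefl)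
    have y't: "poly (pderiv ?y) t \<noteq> 0"
      using pderiv_at_root(1)[OF R Rroot t(2)] lead R(1) by auto
    have "t \<notin> C" using t(1) c(2) by (fastforce simp: C_def)
    define l where "l = lead_coeff ?S"
    have S_eq: "?S = smult l (\<Prod>r\<in>C. [:- r, 1:])"
      unfolding l_def by (rule poly_eq_prod_roots)
        (use injc c(3) in \<open>auto simp: C_def card_image degree_exc_S poly_exc_S\<close>)
    have "finite C" by (simp add: C_def)
    hence "poly (pderiv ?S) t = poly ?S t * (\<Sum>r\<in>C. 1 / (t - r))"
      using poly_pderiv_prod_linear[of C t] \<open>t \<notin> C\<close>
      by (simp add: S_eq pderiv_smult poly_prod)
    also have "(\<Sum>r\<in>C. 1 / (t - r)) = (\<Sum>i<m. 1 / (t + c i))"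
      unfolding C_def using injc by (simp add: sum.reindex)
    finally have S': "poly (pderiv ?S) t = poly ?S t * (\<Sum>i<m. 1 / (t + c i))" .
    have "t \<notin> Z" using t(1) Zneg[of t] by auto
    hence "R - {t} = (X - {t}) \<union> Z" by (auto simp: R_def X)
    hence "(\<Sum>r\<in>R - {t}. 1 / (t - r)) = (\<Sum>r\<in>X - {t}. 1 / (t - r)) + (\<Sum>r\<in>Z. 1 / (t - r))"
      using disj fin by (simp add: X Z_def sum.union_disjoint disjoint_iff)
    also have "(\<Sum>r\<in>Z. 1 / (t - r)) = (\<Sum>i<m. 1 / (t + z i))"
      unfolding Z_def using injz by (simp add: sum.reindex)
    finally have y'': "poly (pderiv (pderiv ?y)) t = 2 * poly (pderiv ?y) t *
        ((\<Sum>r\<in>X - {t}. 1 / (t - r)) + (\<Sum>i<m. 1 / (t + z i)))"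
      using pderiv_at_root(2)[OF R Rroot t(2)] by simp
    \<comment> \<open>Stieltjes' argument: at a zero of y the last term of the equation drops out,
      and y''/y' and S'/S become sums over zeros.\<close>
    have "t * poly ?S t * poly (pderiv ?y) t *
        (D t + 2 * (\<Sum>r\<in>X - {t}. 1 / (t - r))) =
      t * poly ?S t * poly (pderiv (pderiv ?y)) t +
      ((\<alpha> + 1 - t) * poly ?S t - 2 * t * poly (pderiv ?S) t) * poly (pderiv ?y) t"
      unfolding y'' S' D_def using t(1) by (simp add: sum_subtractf field_simps)
    also have "\<dots> = 0" using exc_poly_ode[of t m \<alpha> n] Rroot[OF t(2)] by simp
    finally show ?thesis using t(1) St y't by simp
  qed
  show "log_energy (\<lambda>t. ln (v t)) F < log_energy (\<lambda>t. ln (v t)) X"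
    if F: "finite F" "card F = n" "F \<subseteq> {0<..}" "F \<noteq> X" for F
  proof (rule log_energy_less[OF fin F(1) _ F(4) _ crit])
    show "ln (v u) - ln (v t) < D t * (u - t)" if "t \<in> X" "u \<in> F" "u \<noteq> t" for t u
    proof -
      have "t > 0" "u > 0" using that F(3) Xpos by auto
      thus ?thesis
        unfolding D_def lnv[OF \<open>t > 0\<close>] lnv[OF \<open>u > 0\<close>] using that(3)
        by (intro log_weight_tangent m \<alpha> c(2) cz)
    qed
  qed (use F card in auto)
qed

text \<open>Both equivalences translate the strict maximality of \<open>log_energy\<close> at
  \<open>X\<close>: the weighted energy is its negative, and \<open>fekete_T\<close> its exponential
  on injective tuples.\<close>

theorem theorem2:
  fixes m n :: nat and \<alpha> :: real
  assumes "m \<ge> 1" and "n \<ge> 2" and "\<alpha> \<ge> 1"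
  defines "v \<equiv> exc_v m n \<alpha>"
  defines "X \<equiv> regular_zeros m n \<alpha>"
  shows "(\<forall>F. is_fekete_set (\<lambda>x. v x powr (1 / (2 * (real n - 1)))) {0<..} n F \<longleftrightarrow> F = X)
       \<and> (\<forall>u \<in> {1..n} \<rightarrow> {0<..}.
            (\<forall>w \<in> {1..n} \<rightarrow> {0<..}. fekete_T v n w \<le> fekete_T v n u) \<longleftrightarrow> u ` {1..n} = X)"
proof -
  let ?E = "log_energy (\<lambda>t. ln (v t))"
  have X: "finite X" "card X = n" "X \<subseteq> {0<..}" and v: "\<And>t. t > 0 \<Longrightarrow> v t > 0"
    and less: "\<And>F. finite F \<Longrightarrow> card F = n \<Longrightarrow> F \<subseteq> {0<..} \<Longrightarrow> F \<noteq> X \<Longrightarrow> ?E F < ?E X"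
    using regular_zeros_optimal[OF assms(1,3), where n = n] unfolding v_def X_def by blast+
  have energy: "weighted_energy (\<lambda>x. v x powr (1 / (2 * (real n - 1)))) F = - ?E F"
    if "finite F" "card F = n" "F \<subseteq> {0<..}" for F
    using that assms(2) v by (intro weighted_energy_eq) auto
  have fekete: "is_fekete_set (\<lambda>x. v x powr (1 / (2 * (real n - 1)))) {0<..} n F \<longleftrightarrow> F = X" for F
  proof
    assume F: "is_fekete_set (\<lambda>x. v x powr (1 / (2 * (real n - 1)))) {0<..} n F"
    hence F': "finite F" "card F = n" "F \<subseteq> {0<..}" by (auto simp: is_fekete_set_def)
    have "- ?E F \<le> - ?E X"
      using F X unfolding is_fekete_set_def energy[OF F', symmetric] energy[OF X, symmetric]
      by blast
    thus "F = X" using less[OF F'] by force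
  next
    let ?W = "weighted_energy (\<lambda>x. v x powr (1 / (2 * (real n - 1))))"
    assume "F = X"
    moreover have "?W X \<le> ?W G" if "finite G" "card G = n" "G \<subseteq> {0<..}" for G
      unfolding energy[OF X] energy[OF that] using less[OF that] by (cases "G = X") auto
    ultimately show "is_fekete_set (\<lambda>x. v x powr (1 / (2 * (real n - 1)))) {0<..} n F"
      unfolding is_fekete_set_def using X by blast
  qed
  have T: "fekete_T v n u = exp (?E (u ` {1..n}))"
    if "u \<in> {1..n} \<rightarrow> {0<..}" "inj_on u {1..n}" for u
    by (rule fekete_T_eq_exp[OF that(2)], rule v) (use that(1) in \<open>auto simp: Pi_iff\<close>)
  have maximal: "(\<forall>w \<in> {1..n} \<rightarrow> {0<..}. fekete_T v n w \<le> fekete_T v n u) \<longleftrightarrow> u ` {1..n} = X"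
    if u: "u \<in> {1..n} \<rightarrow> {0<..}" for u
  proof
    assume *: "\<forall>w \<in> {1..n} \<rightarrow> {0<..}. fekete_T v n w \<le> fekete_T v n u"
    \<comment> \<open>An enumeration of \<open>X\<close> is a competitor with positive value, so a
      maximiser \<open>u\<close> has positive value too and no coinciding entries.\<close>
    obtain w where w: "bij_betw w {1..n} X"
      using X by (metis card_atLeastAtMost diff_Suc_1 finite_atLeastAtMost finite_same_card_bij)
    hence w': "w ` {1..n} = X" "inj_on w {1..n}" "w \<in> {1..n} \<rightarrow> {0<..}"
      using X(3) by (auto simp: bij_betw_def)
    hence le: "exp (?E X) \<le> fekete_T v n u" using * T[of w] by metis
    hence "fekete_T v n u \<noteq> 0" by (metis exp_gt_zero not_le)
    hence inj: "inj_on u {1..n}" using fekete_T_eq_0 by blast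
    have "?E X \<le> ?E (u ` {1..n})" using le T[OF u inj] by simp
    moreover have "card (u ` {1..n}) = n" "u ` {1..n} \<subseteq> {0<..}"
      using inj u by (auto simp: card_image)
    ultimately show "u ` {1..n} = X" using less[of "u ` {1..n}"] by force
  next
    assume uX: "u ` {1..n} = X"
    hence "inj_on u {1..n}" using X by (intro eq_card_imp_inj_on) auto
    hence Tu: "fekete_T v n u = exp (?E X)" using T[OF u] uX by simp
    show "\<forall>w \<in> {1..n} \<rightarrow> {0<..}. fekete_T v n w \<le> fekete_T v n u"
    proof
      fix w :: "nat \<Rightarrow> real" assume w: "w \<in> {1..n} \<rightarrow> {0<..}"
      show "fekete_T v n w \<le> fekete_T v n u"
      proof (cases "inj_on w {1..n}")
        case True
        hence "card (w ` {1..n}) = n" "w ` {1..n} \<subseteq> {0<..}"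
          using w by (auto simp: card_image)
        hence "?E (w ` {1..n}) \<le> ?E X"
          using less[of "w ` {1..n}"] by (cases "w ` {1..n} = X") auto
        thus ?thesis using T[OF w True] Tu by simp
      next
        case False
        thus ?thesis using Tu by (simp add: fekete_T_eq_0)
      qed
    qed
  qed
  show ?thesis using fekete maximal by blast
qed

end
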